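(* Let $\mu\in(1,2)$ and $n\ge1$. Then $$\mathcal{T}_n=\bigcup_{i=1}^{n_*}\{I_i,\overline{I}_i\},$$ where $n_*=\min\big(\{i\in\{1,2,\dots,n-1\}: I_{i+1}\in\mathcal{T}_i\}\cup\{n\}\big)$. In particular $|\mathcal{T}_n|\le 2n$.
   Context: Fix $\mu\in(1,2)$. The tent map $f:[0,1]\to[0,1]$ is $f(x)=\mu x$ for $x\le 1/2$ and $f(x)=\mu(1-x)$ for $x\ge 1/2$; $f^n$ is its $n$-fold iterate and $x_i=f^i(x)$. The tent code of $x\in[0,1)$ is $\gamma^n(x)=b_1\cdots b_n$, where $b_1=0$ if $x<1/2$, $b_1=1$ if $x\ge1/2$, and for $i\ge1$: $b_{i+1}=b_i$ if $x_i<1/2$, $b_{i+1}=1-b_i$ if $x_i>1/2$, $b_{i+1}=1$ if $x_i=1/2$. Let $\mathcal{L}_n=\{\gamma^n(x):x\in[0,1)\}$. For $\mathbf{b}\in\mathcal{L}_n$, the section is $S_n(\mathbf{b})=\{x\in[0,1):\gamma^n(x)=\mathbf{b}\}$ and the segment-type is $T(\mathbf{b})=\{f^n(x):x\in S_n(\mathbf{b})\}$; $\mathcal{T}_n=\{T(\mathbf{b}):\mathbf{b}\in\mathcal{L}_n\}$ (a set of intervals). For a bit string $\mathbf{b}$, $\overline{\mathbf{b}}$ is its bitwise complement. Let $\mathbf{c}_i=\gamma^i(1/2)$, $I_i=T(\mathbf{c}_i)$ and $\overline{I}_i=T(\overline{\mathbf{c}_i})$. *)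

theory Defs
  imports Complex_Main
begin

text \<open>Defined on all reals; only its values on the invariant interval \<^term>\<open>{0..1::real}\<close> are used.\<close>

definition tent :: "real \<Rightarrow> real \<Rightarrow> real" where
  "tent \<mu> x = (if x \<le> 1/2 then \<mu> * x else \<mu> * (1 - x))"

text \<open>Bits are booleans, with \<^term>\<open>True\<close> for 1. Indexing is shifted: \<open>tent_bit \<mu> x i\<close> is the bit
  usually written $b_{i+1}$, so that the code $b_1 \cdots b_n$ uses the indices \<open>0..<n\<close>.\<close>

fun tent_bit :: "real \<Rightarrow> real \<Rightarrow> nat \<Rightarrow> bool" where
  "tent_bit \<mu> x 0 \<longleftrightarrow> x \<ge> 1/2"
| "tent_bit \<mu> x (Suc i) \<longleftrightarrow>
     (let y = (tent \<mu> ^^ Suc i) x in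
       if y < 1/2 then tent_bit \<mu> x i
       else if y > 1/2 then \<not> tent_bit \<mu> x i
       else True)"

definition tent_code :: "real \<Rightarrow> nat \<Rightarrow> real \<Rightarrow> bool list" where
  "tent_code \<mu> n x = map (tent_bit \<mu> x) [0..<n]"

definition tent_language :: "real \<Rightarrow> nat \<Rightarrow> bool list set" where
  "tent_language \<mu> n = tent_code \<mu> n ` {0..<1}"

definition tent_section :: "real \<Rightarrow> nat \<Rightarrow> bool list \<Rightarrow> real set" where
  "tent_section \<mu> n b = {x \<in> {0..<1}. tent_code \<mu> n x = b}"

text \<open>Total on bit strings; it is empty exactly on those outside the language, so no such value can
  occur among the \<open>segment_types\<close>.\<close>

definition segment_type :: "real \<Rightarrow> bool list \<Rightarrow> real set" where
  "segment_type \<mu> b = (tent \<mu> ^^ length b) ` tent_section \<mu> (length b) b"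

definition segment_types :: "real \<Rightarrow> nat \<Rightarrow> real set set" where
  "segment_types \<mu> n = segment_type \<mu> ` tent_language \<mu> n"

definition bit_complement :: "bool list \<Rightarrow> bool list" where
  "bit_complement b = map Not b"

definition critical_code :: "real \<Rightarrow> nat \<Rightarrow> bool list" where
  "critical_code \<mu> i = tent_code \<mu> i (1/2)"

definition critical_type :: "real \<Rightarrow> nat \<Rightarrow> real set" where
  "critical_type \<mu> i = segment_type \<mu> (critical_code \<mu> i)"

definition cocritical_type :: "real \<Rightarrow> nat \<Rightarrow> real set" where
  "cocritical_type \<mu> i = segment_type \<mu> (bit_complement (critical_code \<mu> i))"

definition n_star :: "real \<Rightarrow> nat \<Rightarrow> nat" where
  "n_star \<mu> n = Min ({i \<in> {1..n - 1}. critical_type \<mu> (i + 1) \<in> segment_types \<mu> i} \<union> {n})"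

end

theory Submission
  imports Defs
begin

text \<open>
  On the section of a word, \<^term>\<open>tent \<mu> ^^ n\<close> is increasing or decreasing according to the last bit,
  so a segment type is a half-open interval whose closed side is given by the last bit. Appending a
  bit cuts the interval at 1/2 and applies the tent map to one of the pieces; the end points of the
  result do not depend on which side was closed.

  Let \<open>p\<^sub>i\<close> be the pair of end points of the critical type \<open>I\<^sub>i\<close>. One of them is the critical value
  \<open>f\<^sup>i(1/2)\<close>; for \<open>i \<ge> 2\<close> the other is \<open>f\<^sup>k(1/2)\<close> where \<open>i - k\<close> is the last time the critical interval was cut,
  and moreover \<open>p\<^sub>i\<close> lies inside \<open>p\<^sub>k\<close>. Hence, if \<open>p\<^sub>i\<close> is cut at 1/2, then so is \<open>p\<^sub>k\<close>, and the piece of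
  \<open>p\<^sub>i\<close> not followed by the critical orbit has image \<open>p\<^bsub>k+1\<^esub>\<close>; for \<open>i = 1\<close> that image is \<open>p\<^sub>1\<close> itself. So the only descendant of \<open>p\<^sub>1, \<dots>, p\<^sub>n\<close>
  that can be new is \<open>p\<^bsub>n+1\<^esub>\<close>, and once it is not new, nothing new ever appears.
\<close>

section \<open>Cutting half-open intervals at the turning point\<close>

definition half_open :: "real \<times> real \<Rightarrow> bool \<Rightarrow> real set" where
  "half_open p e = (if e then {fst p<..snd p} else {fst p..<snd p})"

definition left_child :: "real \<Rightarrow> real \<times> real \<Rightarrow> real \<times> real" where
  "left_child \<mu> p = (\<mu> * fst p, \<mu> * min (snd p) (1/2))"

definition right_child :: "real \<Rightarrow> real \<times> real \<Rightarrow> real \<times> real" where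
  "right_child \<mu> p = (\<mu> * (1 - snd p), \<mu> * (1 - max (fst p) (1/2)))"

definition children :: "real \<Rightarrow> real \<times> real \<Rightarrow> (real \<times> real) set" where
  "children \<mu> p = (if fst p < 1/2 then {left_child \<mu> p} else {})
                \<union> (if 1/2 < snd p then {right_child \<mu> p} else {})"

definition next_bit :: "bool \<Rightarrow> real \<Rightarrow> bool" where
  "next_bit e y \<longleftrightarrow> (if y < 1/2 then e else if y > 1/2 then \<not> e else True)"

lemma half_open_nonempty: "fst p < snd p \<Longrightarrow> half_open p e \<noteq> {}"
  by (auto simp: half_open_def)

text \<open>Closed on the same side, the ends can be read off; closed on opposite sides, one
  interval has a maximum and the other has none. So the ends are recovered without knowing that the
  bits agree.\<close>

lemma half_open_inject:
  assumes eq: "half_open p e = half_open q d" and p: "fst p < snd p" and q: "fst q < snd q"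
  shows "p = q"
proof -
  have False if "{a<..b} = {c..<d}" "a < b" for a b c d :: real
  proof -
    have "b \<in> {c..<d}" using that by (metis greaterThanAtMost_iff order_refl)
    then have "(b + d) / 2 \<in> {c..<d}" "(b + d) / 2 \<notin> {a<..b}" by auto
    then show False using that by simp
  qed
  note no = this
  show ?thesis
    using eq p q no[of "fst p" "snd p" "fst q" "snd q"] no[of "fst q" "snd q" "fst p" "snd p"]
    by (cases p; cases q; cases e; cases d) (auto simp: half_open_def Ioc_inj atLeastLessThan_eq_iff)
qed

lemma tent_image_half_open_left:
  assumes "0 < \<mu>" "b \<le> 1/2"
  shows "tent \<mu> ` half_open (a, b) e = half_open (\<mu> * a, \<mu> * b) e"
proof -
  have "tent \<mu> ` half_open (a, b) e = (\<lambda>y. \<mu> * y) ` half_open (a, b) e"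
    using assms by (intro image_cong) (auto simp: half_open_def tent_def split: if_splits)
  also have "\<dots> = {z. z / \<mu> \<in> half_open (a, b) e}"
    using assms by (auto intro!: image_eqI[where x = "_ / \<mu>"])
  also have "\<dots> = half_open (\<mu> * a, \<mu> * b) e"
    using assms by (simp add: half_open_def set_eq_iff field_simps)
  finally show ?thesis .
qed

lemma tent_image_half_open_right:
  assumes "0 < \<mu>" "1/2 \<le> a"
  shows "tent \<mu> ` half_open (a, b) e = half_open (\<mu> * (1 - b), \<mu> * (1 - a)) (\<not> e)"
proof -
  have "tent \<mu> ` half_open (a, b) e = (\<lambda>y. \<mu> * (1 - y)) ` half_open (a, b) e"
    using assms by (intro image_cong) (auto simp: half_open_def tent_def split: if_splits)
  also have "\<dots> = {z. 1 - z / \<mu> \<in> half_open (a, b) e}"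
    using assms by (auto intro!: image_eqI[where x = "1 - _ / \<mu>"])
  also have "\<dots> = half_open (\<mu> * (1 - b), \<mu> * (1 - a)) (\<not> e)"
    using assms by (auto simp: half_open_def field_simps)
  finally show ?thesis .
qed

text \<open>The tie rule of \<open>next_bit\<close> puts 1/2 into the left piece if \<open>e\<close>
  holds and into the right piece otherwise, so both pieces stay closed on the side of the whole. The
  bit survives exactly on the left piece, where the tent map is increasing.\<close>

lemma tent_image_same_bit:
  assumes "0 < \<mu>" "fst p < snd p"
  shows "tent \<mu> ` {y \<in> half_open p e. next_bit e y = e} =
           (if fst p < 1/2 then half_open (left_child \<mu> p) e else {})"
proof -
  have "{y \<in> half_open p e. next_bit e y = e} =
          (if fst p < 1/2 then half_open (fst p, min (snd p) (1/2)) e else {})"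
    using assms(2) by (auto simp: half_open_def next_bit_def split: if_splits)
  then show ?thesis
    using assms(1) by (simp add: tent_image_half_open_left left_child_def)
qed

lemma tent_image_flipped_bit:
  assumes "0 < \<mu>" "fst p < snd p"
  shows "tent \<mu> ` {y \<in> half_open p e. next_bit e y = (\<not> e)} =
           (if 1/2 < snd p then half_open (right_child \<mu> p) (\<not> e) else {})"
proof -
  have "{y \<in> half_open p e. next_bit e y = (\<not> e)} =
          (if 1/2 < snd p then half_open (max (fst p) (1/2), snd p) e else {})"
    using assms(2) by (auto simp: half_open_def next_bit_def split: if_splits)
  then show ?thesis
    using assms(1) by (simp add: tent_image_half_open_right right_child_def)
qed

section \<open>Segment types of extended words\<close>

lemma tent_code_Suc: "tent_code \<mu> (Suc n) x = tent_code \<mu> n x @ [tent_bit \<mu> x n]"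
  by (simp add: tent_code_def)

lemma length_tent_code [simp]: "length (tent_code \<mu> n x) = n"
  by (simp add: tent_code_def)

lemma last_tent_code: "last (tent_code \<mu> (Suc n) x) = tent_bit \<mu> x n"
  by (simp add: tent_code_Suc)

lemma tent_bit_Suc:
  "tent_bit \<mu> x (Suc n) = next_bit (tent_bit \<mu> x n) ((tent \<mu> ^^ Suc n) x)"
  by (simp add: next_bit_def Let_def)

text \<open>The next bit of a code depends only on its last bit and the current orbit point, so
  lengthening a word selects part of its segment and maps it once.\<close>

lemma segment_type_append:
  assumes "w \<noteq> []"
  shows "segment_type \<mu> (w @ [d]) = tent \<mu> ` {y \<in> segment_type \<mu> w. next_bit (last w) y = d}"
proof -
  obtain n where n: "length w = Suc n" using assms by (cases w) auto
  have "tent_section \<mu> (Suc (Suc n)) (w @ [d]) =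
          {x \<in> tent_section \<mu> (Suc n) w. next_bit (last w) ((tent \<mu> ^^ Suc n) x) = d}"
    unfolding tent_section_def tent_code_Suc[of \<mu> "Suc n"] tent_bit_Suc
    using last_tent_code[of \<mu> n] by auto
  then show ?thesis
    unfolding segment_type_def by (auto simp: n image_iff)
qed

lemma segment_type_singleton:
  assumes "0 < \<mu>"
  shows "segment_type \<mu> [d] = half_open (0, \<mu>/2) d"
proof -
  \<comment> \<open>The first bit follows the rule for later bits if 0 is taken as a fictitious
    previous bit on \<open>{0..<1}\<close>.\<close>
  have "tent_section \<mu> 1 [d] = {y \<in> half_open (0, 1) False. next_bit False y = d}"
    by (auto simp: tent_section_def tent_code_def half_open_def next_bit_def)
  then show ?thesis
    using tent_image_same_bit[OF assms, of "(0, 1)" False]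
      tent_image_flipped_bit[OF assms, of "(0, 1)" False]
    by (cases d) (simp_all add: segment_type_def left_child_def right_child_def)
qed

lemma tent_language_iff: "w \<in> tent_language \<mu> n \<longleftrightarrow> length w = n \<and> segment_type \<mu> w \<noteq> {}"
  by (auto simp: tent_language_def segment_type_def tent_section_def image_iff)
    (metis atLeastLessThan_iff)

section \<open>The critical intervals\<close>

text \<open>The state is the pair of end points of the critical type together with the last bit of the
  critical code. Index 0 is a seed that makes the recursion uniform: it is the interval
  \<open>[1/2, 1)\<close> and not the type of the empty word.\<close>

fun critical_state :: "real \<Rightarrow> nat \<Rightarrow> (real \<times> real) \<times> bool" where
  "critical_state \<mu> 0 = ((1/2, 1), False)"
| "critical_state \<mu> (Suc n) =
     (case critical_state \<mu> n of (p, e) \<Rightarrow>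
       if (if e then snd p \<le> 1/2 else fst p < 1/2) then (left_child \<mu> p, e)
       else (right_child \<mu> p, \<not> e))"

definition critical_ends :: "real \<Rightarrow> nat \<Rightarrow> real \<times> real" where
  "critical_ends \<mu> n = fst (critical_state \<mu> n)"

definition critical_bit :: "real \<Rightarrow> nat \<Rightarrow> bool" where
  "critical_bit \<mu> n = snd (critical_state \<mu> n)"

text \<open>The end that belongs to the critical interval; it follows the orbit of 1/2.\<close>

definition near_end :: "real \<Rightarrow> nat \<Rightarrow> real" where
  "near_end \<mu> n = (if critical_bit \<mu> n then snd else fst) (critical_ends \<mu> n)"

definition far_end :: "real \<Rightarrow> nat \<Rightarrow> real" where
  "far_end \<mu> n = (if critical_bit \<mu> n then fst else snd) (critical_ends \<mu> n)"

text \<open>Tells whether the near end lies in the left piece, with ties at 1/2 broken as in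
  \<open>next_bit\<close>.\<close>

definition goes_left :: "real \<Rightarrow> nat \<Rightarrow> bool" where
  "goes_left \<mu> n \<longleftrightarrow>
     (if critical_bit \<mu> n then snd (critical_ends \<mu> n) \<le> 1/2 else fst (critical_ends \<mu> n) < 1/2)"

lemma critical_ends_Suc:
  "critical_ends \<mu> (Suc n) =
     (if goes_left \<mu> n then left_child else right_child) \<mu> (critical_ends \<mu> n)"
  and critical_bit_Suc: "critical_bit \<mu> (Suc n) = (critical_bit \<mu> n = goes_left \<mu> n)"
  by (auto simp: critical_ends_def critical_bit_def goes_left_def split: prod.split)

lemma critical_ends_1: "critical_ends \<mu> 1 = (0, \<mu>/2)"
  and critical_bit_1: "critical_bit \<mu> 1"
  by (simp_all add: critical_ends_def critical_bit_def right_child_def)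

context
  fixes \<mu> :: real
  assumes mu: "1 < \<mu>" "\<mu> < 2"
begin

lemma critical_ends_bounds:
  "0 \<le> fst (critical_ends \<mu> n)" "fst (critical_ends \<mu> n) < snd (critical_ends \<mu> n)"
  "snd (critical_ends \<mu> n) \<le> 1"
proof (induction n)
  case (Suc n)
  obtain a b where ab: "critical_ends \<mu> n = (a, b)" by fastforce
  have b: "0 \<le> a" "a < b" "b \<le> 1" using Suc ab by auto
  have le1: "\<mu> * m \<le> 1" if "m \<le> 1/2" for m
  proof -
    have "\<mu> * m \<le> \<mu> * (1/2)" using that mu by (intro mult_left_mono) auto
    also have "\<dots> \<le> 1" using mu by simp
    finally show ?thesis .
  qed
  show "0 \<le> fst (critical_ends \<mu> (Suc n))"
    "fst (critical_ends \<mu> (Suc n)) < snd (critical_ends \<mu> (Suc n))"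
    "snd (critical_ends \<mu> (Suc n)) \<le> 1"
    using b mu by (auto simp: critical_ends_Suc ab left_child_def right_child_def goes_left_def
                          intro!: mult_strict_left_mono le1 split: if_splits)
qed (simp_all add: critical_ends_def)

lemma near_end_Suc: "near_end \<mu> (Suc n) = tent \<mu> (near_end \<mu> n)"
  using critical_ends_bounds[of n]
  by (auto simp: near_end_def critical_ends_Suc critical_bit_Suc goes_left_def left_child_def
      right_child_def tent_def min_def max_def)

lemma near_end_eq: "near_end \<mu> n = (tent \<mu> ^^ n) (1/2)"
  by (induction n) (simp_all add: near_end_Suc, simp add: near_end_def critical_ends_def critical_bit_def)

lemma next_bit_near_end: "next_bit (critical_bit \<mu> n) (near_end \<mu> n) = critical_bit \<mu> (Suc n)"
  using critical_ends_bounds[of n]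
  by (auto simp: near_end_def critical_bit_Suc goes_left_def next_bit_def)

lemma tent_bit_half: "tent_bit \<mu> (1/2) n = critical_bit \<mu> (Suc n)"
proof (induction n)
  case 0
  show ?case using critical_bit_1 by simp
next
  case (Suc n)
  show ?case
    unfolding tent_bit_Suc Suc near_end_eq[symmetric] by (rule next_bit_near_end)
qed

lemma critical_code_Suc: "critical_code \<mu> (Suc n) = critical_code \<mu> n @ [critical_bit \<mu> (Suc n)]"
  by (simp add: critical_code_def tent_code_Suc tent_bit_half)

text \<open>The last bit of \<open>w\<close> is arbitrary, so this one step serves both the critical
  codes and their complements: they visit the same end points with opposite closed sides.\<close>

lemma critical_code_append_type:
  assumes "w \<noteq> []" and "segment_type \<mu> w = half_open (critical_ends \<mu> n) (last w)"
  shows "segment_type \<mu> (w @ [last w = goes_left \<mu> n])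
           = half_open (critical_ends \<mu> (Suc n)) (last w = goes_left \<mu> n)"
proof -
  have "goes_left \<mu> n \<Longrightarrow> fst (critical_ends \<mu> n) < 1/2"
    "\<not> goes_left \<mu> n \<Longrightarrow> 1/2 < snd (critical_ends \<mu> n)"
    using critical_ends_bounds[of n] by (auto simp: goes_left_def split: if_splits)
  then show ?thesis
    using tent_image_same_bit[of \<mu> "critical_ends \<mu> n" "last w"]
      tent_image_flipped_bit[of \<mu> "critical_ends \<mu> n" "last w"]
      critical_ends_bounds[of n] mu
    by (cases "goes_left \<mu> n")
      (simp_all add: segment_type_append[OF assms(1)] assms(2) critical_ends_Suc)
qed

lemma critical_type_eq:
  "critical_type \<mu> (Suc n) = half_open (critical_ends \<mu> (Suc n)) (critical_bit \<mu> (Suc n))"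
proof (induction n)
  case 0
  show ?case
    using mu critical_ends_1 critical_bit_1
    by (simp add: critical_type_def critical_code_Suc segment_type_singleton)
      (simp add: critical_code_def tent_code_def segment_type_singleton)
next
  case (Suc n)
  have "critical_code \<mu> (Suc n) \<noteq> []" "last (critical_code \<mu> (Suc n)) = critical_bit \<mu> (Suc n)"
    by (simp_all add: critical_code_Suc)
  then show ?case
    using critical_code_append_type[of "critical_code \<mu> (Suc n)" "Suc n"] Suc
    by (simp add: critical_type_def critical_code_Suc[of "Suc n"] critical_bit_Suc[of \<mu> "Suc n"])
qed

lemma cocritical_type_eq:
  "cocritical_type \<mu> (Suc n) = half_open (critical_ends \<mu> (Suc n)) (\<not> critical_bit \<mu> (Suc n))"
proof (induction n)
  case 0
  show ?case
    using mu critical_ends_1 critical_bit_1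
    by (simp add: cocritical_type_def critical_code_Suc segment_type_singleton)
      (simp add: critical_code_def tent_code_def bit_complement_def segment_type_singleton)
next
  case (Suc n)
  let ?w = "bit_complement (critical_code \<mu> (Suc n))"
  have "?w \<noteq> []" "last ?w = (\<not> critical_bit \<mu> (Suc n))"
    by (simp_all add: critical_code_Suc bit_complement_def)
  moreover have "bit_complement (critical_code \<mu> (Suc (Suc n))) =
      ?w @ [\<not> critical_bit \<mu> (Suc (Suc n))]"
    by (simp add: critical_code_Suc[of "Suc n"] bit_complement_def)
  moreover have "(\<not> critical_bit \<mu> (Suc (Suc n))) = ((\<not> critical_bit \<mu> (Suc n)) = goes_left \<mu> (Suc n))"
    by (auto simp: critical_bit_Suc[of \<mu> "Suc n"])
  ultimately show ?case
    using critical_code_append_type[of ?w "Suc n"] Suc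
    by (simp add: cocritical_type_def)
qed

section \<open>Closure of the critical intervals under taking children\<close>

text \<open>A cut resets \<open>k\<close> to 1, since the image then reaches up to \<mu>/2, the near
  end of the first interval. Without a cut, both intervals move by the same branch and
  \<open>k\<close> advances with \<open>n\<close>.\<close>

lemma critical_ends_nested:
  assumes "2 \<le> n"
  shows "\<exists>k\<ge>1. k < n \<and> far_end \<mu> n = near_end \<mu> k
           \<and> fst (critical_ends \<mu> k) \<le> fst (critical_ends \<mu> n)
           \<and> snd (critical_ends \<mu> n) \<le> snd (critical_ends \<mu> k)"
proof -
  define nested where "nested n \<longleftrightarrow> (\<exists>k\<ge>1. k < n \<and> far_end \<mu> n = near_end \<mu> k
           \<and> fst (critical_ends \<mu> k) \<le> fst (critical_ends \<mu> n)
           \<and> snd (critical_ends \<mu> n) \<le> snd (critical_ends \<mu> k))" for n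
  have cut: "nested (Suc n)"
    if n: "1 \<le> n" and lt: "fst (critical_ends \<mu> n) < 1/2" "1/2 < snd (critical_ends \<mu> n)" for n
  proof -
    have "snd (critical_ends \<mu> (Suc n)) = \<mu>/2" "\<not> critical_bit \<mu> (Suc n)"
      using lt by (auto simp: critical_ends_Suc critical_bit_Suc goes_left_def left_child_def
          right_child_def min_def max_def)
    then show ?thesis
      using n critical_ends_bounds[of "Suc n"] critical_ends_1[of \<mu>] critical_bit_1[of \<mu>]
      unfolding nested_def
      by (intro exI[of _ 1]) (simp add: far_end_def near_end_def)
  qed
  have "nested n"
    using assms
  proof (induction n rule: dec_induct)
    case base
    have "nested (Suc 1)"
      using mu by (intro cut) (simp_all add: critical_ends_1[unfolded One_nat_def])
    then show ?case by (simp add: numeral_2_eq_2)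
  next
    case (step n)
    show ?case
    proof (cases "fst (critical_ends \<mu> n) < 1/2 \<and> 1/2 < snd (critical_ends \<mu> n)")
      case True
      then show ?thesis using step cut by simp
    next
      case uncut: False
      obtain k where k: "1 \<le> k" "k < n" "far_end \<mu> n = near_end \<mu> k"
        "fst (critical_ends \<mu> k) \<le> fst (critical_ends \<mu> n)"
        "snd (critical_ends \<mu> n) \<le> snd (critical_ends \<mu> k)"
        using step.IH unfolding nested_def by auto
      \<comment> \<open>The uncut interval lies on one side of 1/2, and its far end is the near end
        that decides the branch for \<open>k\<close>.\<close>
      have side: "goes_left \<mu> k = goes_left \<mu> n"
        using uncut k(3-5) critical_ends_bounds[of n] critical_ends_bounds[of k]
        by (auto simp: goes_left_def far_end_def near_end_def split: if_splits)
      have far: "far_end \<mu> (Suc n) = tent \<mu> (far_end \<mu> n)"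
        using uncut critical_ends_bounds[of n]
        by (auto simp: far_end_def critical_ends_Suc critical_bit_Suc goes_left_def left_child_def
            right_child_def tent_def min_def max_def)
      have "fst (critical_ends \<mu> (Suc k)) \<le> fst (critical_ends \<mu> (Suc n))
          \<and> snd (critical_ends \<mu> (Suc n)) \<le> snd (critical_ends \<mu> (Suc k))"
        using k(4,5) mu by (auto simp: critical_ends_Suc side left_child_def right_child_def)
      then show ?thesis
        unfolding nested_def using k far near_end_Suc[of k]
        by (intro exI[of _ "Suc k"]) auto
    qed
  qed
  then show ?thesis unfolding nested_def .
qed

lemma critical_ends_Suc_in_children: "critical_ends \<mu> (Suc n) \<in> children \<mu> (critical_ends \<mu> n)"
  using critical_ends_bounds[of n]
  by (auto simp: critical_ends_Suc children_def goes_left_def)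

lemma children_critical_ends_subset:
  assumes "1 \<le> n"
  shows "children \<mu> (critical_ends \<mu> n) \<subseteq> critical_ends \<mu> ` {1..Suc n}"
proof (cases "fst (critical_ends \<mu> n) < 1/2 \<and> 1/2 < snd (critical_ends \<mu> n)")
  case False
  then have "children \<mu> (critical_ends \<mu> n) \<subseteq> {critical_ends \<mu> (Suc n)}"
    using critical_ends_bounds[of n]
    by (auto simp: critical_ends_Suc children_def goes_left_def)
  then show ?thesis by auto
next
  case cut: True
  define other where
    "other = (if goes_left \<mu> n then right_child else left_child) \<mu> (critical_ends \<mu> n)"
  have "children \<mu> (critical_ends \<mu> n) = {critical_ends \<mu> (Suc n), other}"
    using cut by (auto simp: critical_ends_Suc children_def other_def)
  moreover have "other \<in> critical_ends \<mu> ` {1..Suc n}"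
  proof (cases "n = 1")
    case True
    \<comment> \<open>The first interval runs from 0 to \<mu>/2 > 1/2; its left piece, from 0 to
      1/2, is mapped back onto it.\<close>
    then have "other = critical_ends \<mu> 1"
      using mu critical_ends_1[of \<mu>] critical_bit_1[of \<mu>]
      by (simp add: other_def goes_left_def left_child_def)
    then show ?thesis by auto
  next
    case False
    then obtain k where k: "1 \<le> k" "k < n" "far_end \<mu> n = near_end \<mu> k"
      "fst (critical_ends \<mu> k) \<le> fst (critical_ends \<mu> n)"
      "snd (critical_ends \<mu> n) \<le> snd (critical_ends \<mu> k)"
      using critical_ends_nested[of n] assms by auto
    \<comment> \<open>The \<open>k\<close>-th interval contains the \<open>n\<close>-th, so it is
      cut too. Its near end is the far end of the \<open>n\<close>-th, hence the piece it follows is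
      the one that the \<open>n\<close>-th abandons.\<close>
    have "other = critical_ends \<mu> (Suc k)"
      using cut k(3-5)
      by (auto simp: other_def critical_ends_Suc goes_left_def far_end_def near_end_def
          left_child_def right_child_def split: if_splits)
    then show ?thesis using k by auto
  qed
  ultimately show ?thesis by auto
qed

lemma children_critical_ends:
  assumes "1 \<le> n"
  shows "(\<Union>p\<in>critical_ends \<mu> ` {1..n}. children \<mu> p) = critical_ends \<mu> ` {1..Suc n}"
proof (intro equalityI subsetI)
  fix q assume "q \<in> (\<Union>p\<in>critical_ends \<mu> ` {1..n}. children \<mu> p)"
  then obtain i where "1 \<le> i" "i \<le> n" "q \<in> children \<mu> (critical_ends \<mu> i)" by auto
  then show "q \<in> critical_ends \<mu> ` {1..Suc n}"
    using children_critical_ends_subset[of i] by fastforce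
next
  fix q assume "q \<in> critical_ends \<mu> ` {1..Suc n}"
  then obtain i where i: "1 \<le> i" "i \<le> Suc n" "q = critical_ends \<mu> i" by auto
  show "q \<in> (\<Union>p\<in>critical_ends \<mu> ` {1..n}. children \<mu> p)"
  proof (cases "i = 1")
    case True
    \<comment> \<open>The first interval has no predecessor in the range but is its own left
      child.\<close>
    have "q \<in> children \<mu> (critical_ends \<mu> 1)"
      using i True mu critical_ends_1[of \<mu>] by (simp add: children_def left_child_def)
    then show ?thesis using assms by auto
  next
    case False
    then obtain j where j: "i = Suc j" "1 \<le> j" using i by (cases i) auto
    then show ?thesis using i critical_ends_Suc_in_children[of j] by auto
  qed
qed

section \<open>All segment types\<close>

text \<open>Remembering the last bit alongside the segment type makes the passage from length \<open>n\<close> to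
  \<open>n + 1\<close> a function of the recorded data.\<close>

definition marked_types :: "nat \<Rightarrow> (real set \<times> bool) set" where
  "marked_types n = (\<lambda>w. (segment_type \<mu> w, last w)) ` tent_language \<mu> n"

lemma segment_types_eq_fst_marked: "segment_types \<mu> n = fst ` marked_types n"
  by (simp add: segment_types_def marked_types_def image_image)

lemma marked_types_Suc:
  assumes "1 \<le> n"
  shows "marked_types (Suc n) =
    {(tent \<mu> ` {y \<in> X. next_bit e y = d}, d) |X e d.
       (X, e) \<in> marked_types n \<and> tent \<mu> ` {y \<in> X. next_bit e y = d} \<noteq> {}}" (is "_ = ?R")
proof (intro equalityI subsetI)
  fix z assume "z \<in> marked_types (Suc n)"
  then obtain v where v: "length v = Suc n" "segment_type \<mu> v \<noteq> {}" "z = (segment_type \<mu> v, last v)"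
    unfolding marked_types_def image_iff Bex_def tent_language_iff by blast
  then obtain w d where w: "v = w @ [d]" "length w = n" by (metis length_Suc_conv_rev)
  then have "w \<noteq> []" using assms by auto
  note app = segment_type_append[OF this, of \<mu> d]
  have "(segment_type \<mu> w, last w) \<in> marked_types n"
    unfolding marked_types_def using v w app by (intro imageI) (auto simp: tent_language_iff)
  then show "z \<in> ?R" using v w app by auto
next
  fix z assume "z \<in> ?R"
  then obtain w d where w: "w \<in> tent_language \<mu> n"
    and ne: "{y \<in> segment_type \<mu> w. next_bit (last w) y = d} \<noteq> {}"
    and z: "z = (tent \<mu> ` {y \<in> segment_type \<mu> w. next_bit (last w) y = d}, d)"
    by (auto simp: marked_types_def)
  have "w \<noteq> []" using w assms by (auto simp: tent_language_iff)
  note app = segment_type_append[OF this, of \<mu> d]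
  have "w @ [d] \<in> tent_language \<mu> (Suc n)"
    using w ne app by (auto simp: tent_language_iff)
  then show "z \<in> marked_types (Suc n)"
    unfolding marked_types_def by (rule rev_image_eqI) (simp add: app z)
qed

text \<open>For a new bit \<open>d\<close>, the old bit \<open>d\<close> yields the left child and
  the old bit \<open>\<not> d\<close> the right one. As every pair in \<open>P\<close> occurs with
  both bits, so does every child.\<close>

lemma marked_types_half_open_Suc:
  assumes n: "1 \<le> n" and P: "\<And>p. p \<in> P \<Longrightarrow> fst p < snd p"
    and M: "marked_types n = {(half_open p e, e) |p e. p \<in> P}"
  shows "marked_types (Suc n) = {(half_open q d, d) |q d. q \<in> (\<Union>p\<in>P. children \<mu> p)}"
proof -
  have mu0: "0 < \<mu>" using mu by simp
  note same = tent_image_same_bit[OF mu0 P] and flip = tent_image_flipped_bit[OF mu0 P]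
  have piece: "(\<exists>e. tent \<mu> ` {y \<in> half_open p e. next_bit e y = d} \<noteq> {} \<and>
                    X = tent \<mu> ` {y \<in> half_open p e. next_bit e y = d})
      \<longleftrightarrow> (\<exists>q\<in>children \<mu> p. X = half_open q d)" if p: "p \<in> P" for p d X
  proof -
    have ex: "(\<exists>e. Q e) \<longleftrightarrow> Q d \<or> Q (\<not> d)" for Q by (cases d) (auto simp: ex_bool_eq)
    have l: "fst p < 1/2 \<Longrightarrow> half_open (left_child \<mu> p) d \<noteq> {}"
      and r: "1/2 < snd p \<Longrightarrow> half_open (right_child \<mu> p) d \<noteq> {}"
      using P[OF p] mu by (auto intro!: half_open_nonempty simp: left_child_def right_child_def)
    show ?thesis
      unfolding ex using same[OF p, of d] flip[OF p, of "\<not> d"] l r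
      by (auto simp: children_def simp del: image_is_empty)
  qed
  show ?thesis
    unfolding marked_types_Suc[OF n] M
  proof (intro equalityI subsetI)
    fix z assume "z \<in> {(tent \<mu> ` {y \<in> X. next_bit e y = d}, d) |X e d.
       (X, e) \<in> {(half_open p e, e) |p e. p \<in> P} \<and> tent \<mu> ` {y \<in> X. next_bit e y = d} \<noteq> {}}"
    then obtain p e d where "p \<in> P" "tent \<mu> ` {y \<in> half_open p e. next_bit e y = d} \<noteq> {}"
      "z = (tent \<mu> ` {y \<in> half_open p e. next_bit e y = d}, d)" by blast
    then show "z \<in> {(half_open q d, d) |q d. q \<in> (\<Union>p\<in>P. children \<mu> p)}"
      using piece[of p d "fst z"] by fastforce
  next
    fix z assume "z \<in> {(half_open q d, d) |q d. q \<in> (\<Union>p\<in>P. children \<mu> p)}"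
    then obtain p q d where "p \<in> P" "q \<in> children \<mu> p" "z = (half_open q d, d)" by blast
    moreover from this obtain e where "tent \<mu> ` {y \<in> half_open p e. next_bit e y = d} \<noteq> {}"
      "half_open q d = tent \<mu> ` {y \<in> half_open p e. next_bit e y = d}"
      using piece[of p d "half_open q d"] by blast
    ultimately show "z \<in> {(tent \<mu> ` {y \<in> X. next_bit e y = d}, d) |X e d.
       (X, e) \<in> {(half_open p e, e) |p e. p \<in> P} \<and> tent \<mu> ` {y \<in> X. next_bit e y = d} \<noteq> {}}"
      by blast
  qed
qed

lemma marked_types_eq:
  assumes "1 \<le> n"
  shows "marked_types n = {(half_open p e, e) |p e. p \<in> critical_ends \<mu> ` {1..n}}"
  using assms
proof (induction n rule: dec_induct)
  case base
  have L: "tent_language \<mu> 1 = range (\<lambda>d. [d])"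
  proof -
    have "segment_type \<mu> [d] \<noteq> {}" for d
      using mu half_open_nonempty[of "(0, \<mu>/2)" d] by (simp add: segment_type_singleton)
    moreover have "length w = 1 \<longleftrightarrow> (\<exists>d. w = [d])" for w :: "bool list"
      by (auto simp: length_Suc_conv)
    ultimately show ?thesis by (auto simp: tent_language_iff)
  qed
  have types: "marked_types 1 = {(half_open (0, \<mu>/2) d, d) |d. True}"
    using mu unfolding marked_types_def L image_image by (auto simp: segment_type_singleton)
  have ends: "critical_ends \<mu> ` {1..1} = {(0, \<mu>/2)}"
    using critical_ends_1[of \<mu>] by simp
  show ?case unfolding types ends by blast
next
  case (step n)
  have "marked_types (Suc n) =
      {(half_open q d, d) |q d. q \<in> (\<Union>p\<in>critical_ends \<mu> ` {1..n}. children \<mu> p)}"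
    using critical_ends_bounds(2)
    by (intro marked_types_half_open_Suc[OF step(1) _ step.IH]) blast
  then show ?case
    unfolding children_critical_ends[OF step(1)] .
qed

lemma segment_types_eq:
  assumes "1 \<le> n"
  shows "segment_types \<mu> n = {half_open p e |p e. p \<in> critical_ends \<mu> ` {1..n}}"
proof -
  have "fst ` {(g p e, e) |p e. p \<in> P} = {g p e |p e. p \<in> P}"
    for g :: "real \<times> real \<Rightarrow> bool \<Rightarrow> real set" and P
    by force
  then show ?thesis
    unfolding segment_types_eq_fst_marked marked_types_eq[OF assms] .
qed

section \<open>Truncation at \<open>n_star\<close>\<close>

lemma Union_critical_types:
  "(\<Union>i\<in>{1..n}. {critical_type \<mu> i, cocritical_type \<mu> i}) =
     {half_open p e |p e. p \<in> critical_ends \<mu> ` {1..n}}"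
proof -
  have "{critical_type \<mu> i, cocritical_type \<mu> i} = {half_open (critical_ends \<mu> i) e |e. True}"
    if i: "i \<in> {1..n}" for i
  proof -
    obtain j where "i = Suc j" using i by (cases i) auto
    then show ?thesis
      using critical_type_eq[of j] cocritical_type_eq[of j]
      by (cases "critical_bit \<mu> (Suc j)") (auto simp: ex_bool_eq)
  qed
  then have "(\<Union>i\<in>{1..n}. {critical_type \<mu> i, cocritical_type \<mu> i}) =
      (\<Union>i\<in>{1..n}. {half_open (critical_ends \<mu> i) e |e. True})"
    by (intro SUP_cong) auto
  also have "\<dots> = {half_open p e |p e. p \<in> critical_ends \<mu> ` {1..n}}"
    by blast
  finally show ?thesis .
qed

text \<open>Each set of end pairs is determined by the previous one through \<open>children\<close>,
  so a single repetition freezes it.\<close>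

lemma critical_ends_saturated:
  assumes "1 \<le> i" "critical_ends \<mu> (Suc i) \<in> critical_ends \<mu> ` {1..i}" "i \<le> n"
  shows "critical_ends \<mu> ` {1..n} = critical_ends \<mu> ` {1..i}"
  using assms(3)
proof (induction n rule: dec_induct)
  case (step n)
  have "critical_ends \<mu> ` {1..Suc n} = (\<Union>p\<in>critical_ends \<mu> ` {1..n}. children \<mu> p)"
    using children_critical_ends[of n] assms(1) step.hyps(1) by simp
  also have "\<dots> = critical_ends \<mu> ` {1..Suc i}"
    unfolding step.IH using children_critical_ends[OF assms(1)] .
  also have "\<dots> = critical_ends \<mu> ` {1..i}"
    using assms(2) by (auto simp: atLeastAtMostSuc_conv)
  finally show ?case .
qed simp

lemma critical_ends_n_star:
  assumes "1 \<le> n"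
  shows "critical_ends \<mu> ` {1..n_star \<mu> n} = critical_ends \<mu> ` {1..n}"
proof -
  let ?S = "{i \<in> {1..n - 1}. critical_type \<mu> (i + 1) \<in> segment_types \<mu> i}"
  have "n_star \<mu> n \<in> ?S \<union> {n}"
    unfolding n_star_def by (rule Min_in) auto
  then consider "n_star \<mu> n = n" | "n_star \<mu> n \<in> ?S" by blast
  then show ?thesis
  proof cases
    case 2
    define i where "i = n_star \<mu> n"
    have i: "1 \<le> i" "i \<le> n" "critical_type \<mu> (Suc i) \<in> segment_types \<mu> i"
      using 2 by (auto simp: i_def)
    then obtain p e where p: "p \<in> critical_ends \<mu> ` {1..i}"
      "half_open (critical_ends \<mu> (Suc i)) (critical_bit \<mu> (Suc i)) = half_open p e"
      by (auto simp: segment_types_eq critical_type_eq)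
    \<comment> \<open>\<open>n_star\<close> speaks of types, saturation of end pairs; the recurring
      type may come from either closed side, and injectivity covers both.\<close>
    then have "critical_ends \<mu> (Suc i) = p"
      using critical_ends_bounds by (intro half_open_inject[OF p(2)]) auto
    then show ?thesis
      using critical_ends_saturated[of i n] i p by (simp add: i_def)
  qed simp
qed

end

theorem theorem2:
  fixes \<mu> :: real and n :: nat
  assumes "1 < \<mu>" and "\<mu> < 2" and "n \<ge> 1"
  shows "segment_types \<mu> n =
           (\<Union>i\<in>{1..n_star \<mu> n}. {critical_type \<mu> i, cocritical_type \<mu> i})
         \<and> finite (segment_types \<mu> n) \<and> card (segment_types \<mu> n) \<le> 2 * n"
proof (intro conjI)
  note mu = assms(1,2)
  show "segment_types \<mu> n = (\<Union>i\<in>{1..n_star \<mu> n}. {critical_type \<mu> i, cocritical_type \<mu> i})"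
    unfolding segment_types_eq[OF mu assms(3)] Union_critical_types[OF mu]
      critical_ends_n_star[OF mu assms(3)] ..
  \<comment> \<open>For the count, the union over all indices up to \<open>n\<close> is enough: each
    index contributes at most two types.\<close>
  have all: "segment_types \<mu> n = (\<Union>i\<in>{1..n}. {critical_type \<mu> i, cocritical_type \<mu> i})"
    unfolding segment_types_eq[OF mu assms(3)] Union_critical_types[OF mu] ..
  then show "finite (segment_types \<mu> n)" by simp
  have "card (segment_types \<mu> n) \<le> (\<Sum>i\<in>{1..n}. card {critical_type \<mu> i, cocritical_type \<mu> i})"
    unfolding all by (rule card_UN_le) simp
  also have "\<dots> \<le> (\<Sum>i\<in>{1..n}. 2)"
    by (intro sum_mono) (simp add: card_insert_if)
  finally show "card (segment_types \<mu> n) \<le> 2 * n" by simp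
qed

end
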